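(* Let $\mathcal{H}$ be a real Hilbert space and let $\mathcal{S},\mathcal{T}:\mathcal{H}\to\mathcal{H}$ be nonexpansive mappings such that $\Omega:=\operatorname{Fix}(\mathcal{T})\cap\operatorname{Fix}(\mathcal{S})\neq\emptyset$. Let $y_1\in\mathcal{H}$ and let $\{y_n\}$ be the sequence defined by $$y_{n+1}=\mathcal{S}\big[(1-\theta_n)e_ny_n+\theta_n\mathcal{T}(e_ny_n)\big]\qquad\text{for all } n\in\mathbb{N},$$ where $\{\theta_n\}$ and $\{e_n\}$ are real sequences satisfying: (i) $0<e_n<1$ for all $n\in\mathbb{N}$, $\lim_{n\to\infty}e_n=1$, $\sum_{n=1}^{\infty}(1-e_n)=\infty$ and $\sum_{n=2}^{\infty}|e_n-e_{n-1}|<\infty$; (ii) there are constants $\underline{\theta},\overline{\theta}$ with $0<\underline{\theta}\le\theta_n\le\overline{\theta}<1$ for all $n\in\mathbb{N}$, and $\sum_{n=2}^{\infty}|\theta_n-\theta_{n-1}|<\infty$. Then $\{y_n\}$ converges strongly to $\operatorname{proj}_{\Omega}(0)$.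
   Context: $\mathbb{N}=\{1,2,\dots\}$. A map $T:\mathcal{H}\to\mathcal{H}$ is nonexpansive if $\|Tx-Ty\|\le\|x-y\|$ for all $x,y$. $\operatorname{Fix}(T)$ is the set of fixed points of $T$. $\operatorname{proj}_C$ is the metric projection onto a nonempty closed convex set $C$. Strong convergence means convergence in norm. *)

theory Defs
  imports "HOL-Analysis.Analysis"
begin

definition nonexpansive :: "('a::real_normed_vector \<Rightarrow> 'a) \<Rightarrow> bool"
  where "nonexpansive T \<longleftrightarrow> (\<forall>x y. norm (T x - T y) \<le> norm (x - y))"

definition Fix :: "('a \<Rightarrow> 'a) \<Rightarrow> 'a set"
  where "Fix T = {x. T x = x}"

text \<open>The library's \<open>closest_point\<close> is restricted to Heine--Borel spaces, which excludes
  infinite-dimensional Hilbert spaces. The description below denotes the metric projection when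
  \<open>C\<close> is a nonempty closed convex subset of a Hilbert space; otherwise a unique nearest point
  need not exist.\<close>

definition proj :: "'a::real_inner set \<Rightarrow> 'a \<Rightarrow> 'a"
  where "proj C x = (THE p. p \<in> C \<and> (\<forall>z\<in>C. norm (x - p) \<le> norm (x - z)))"

end

theory Submission
  imports Defs
begin

text \<open>
  Put \<open>U = (S + T) / 2\<close>; in a Hilbert space \<open>Fix U = Fix T \<inter> Fix S\<close>. Since \<open>I - U\<close> is monotone, the
  solutions of \<open>x - U x = - t x\<close> have norms that increase as \<open>t\<close> decreases to 0, and they converge
  in norm to the point \<open>p\<close> of \<open>Fix U\<close> of least norm. The same monotonicity shows
  \<open>limsup \<langle>p, p - z\<^sub>n\<rangle> \<le> 0\<close> for every bounded sequence with \<open>z\<^sub>n - U z\<^sub>n \<rightarrow> 0\<close>, so that weak compactness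
  and demiclosedness are not needed. The sequence \<open>z\<^sub>n = e\<^sub>n y\<^sub>n\<close> is of this kind: \<open>y\<^sub>n\<^sub>+\<^sub>1 - y\<^sub>n \<rightarrow> 0\<close> by
  a recursive inequality of Xu's type, and then \<open>z\<^sub>n - T z\<^sub>n \<rightarrow> 0\<close> by uniform convexity. Xu's inequality,
  applied once more to \<open>\<parallel>y\<^sub>n - p\<parallel>\<^sup>2\<close>, gives the claim.
\<close>

section \<open>A recursive inequality for real sequences\<close>

text \<open>Once \<open>b\<close> stays below \<epsilon>, three terms bound \<open>a n\<close>:
  \<epsilon>, a tail of the convergent series of \<open>c\<close>, and a starting value damped by
  the product of the factors \<open>1 - \<alpha> i\<close>, which tends to 0 because the sum of the
  \<alpha> diverges. The hypothesis on \<open>b\<close> says that its limsup is at most 0.\<close>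

lemma xu_recursion_tendsto_0:
  fixes a \<alpha> b c :: "nat \<Rightarrow> real"
  assumes a: "\<And>n. 0 \<le> a n"
    and \<alpha>: "\<And>n. 0 \<le> \<alpha> n" "\<And>n. \<alpha> n \<le> 1"
    and div: "filterlim (\<lambda>n. \<Sum>i<n. \<alpha> i) at_top sequentially"
    and b: "\<And>\<epsilon>. \<epsilon> > 0 \<Longrightarrow> \<forall>\<^sub>F n in sequentially. b n \<le> \<epsilon>"
    and c: "\<And>n. 0 \<le> c n" "summable c"
    and rec: "\<And>n. a (Suc n) \<le> (1 - \<alpha> n) * a n + \<alpha> n * b n + c n"
  shows "a \<longlonglongrightarrow> 0"
proof (rule LIMSEQ_I)
  fix r :: real assume "r > 0"
  define \<epsilon> where "\<epsilon> = r / 3"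
  have \<epsilon>: "\<epsilon> > 0" using \<open>r > 0\<close> by (simp add: \<epsilon>_def)
  define A where "A n = (\<Sum>i<n. \<alpha> i)" for n
  define C where "C n = (\<Sum>i<n. c i)" for n
  have "Cauchy C"
    using c(2) unfolding C_def by (simp add: summable_iff_convergent convergent_Cauchy)
  then obtain N1 where N1: "\<And>m n. m \<ge> N1 \<Longrightarrow> n \<ge> N1 \<Longrightarrow> norm (C m - C n) < \<epsilon>"
    using \<epsilon> CauchyD by blast
  obtain N2 where N2: "\<And>n. n \<ge> N2 \<Longrightarrow> b n \<le> \<epsilon>"
    using b[OF \<epsilon>] by (auto simp: eventually_sequentially)
  define N where "N = max N1 N2"
  \<comment> \<open>The inequality \<open>1 - s \<le> exp (- s)\<close> replaces the product of the
    factors \<open>1 - \<alpha> i\<close> by the exponential of minus a partial sum.\<close>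
  have bound: "a n \<le> \<epsilon> + (C n - C N) + a N * exp (- (A n - A N))" if "n \<ge> N" for n
    using that
  proof (induction n rule: dec_induct)
    case base
    then show ?case using \<epsilon> by simp
  next
    case (step n)
    define P where "P = a N * exp (- (A n - A N))"
    have P: "P \<ge> 0" using a by (simp add: P_def)
    have "C N \<le> C n"
      unfolding C_def using step c(1) by (intro sum_mono2) auto
    have "a (Suc n) \<le> (1 - \<alpha> n) * a n + \<alpha> n * b n + c n" by (rule rec)
    also have "\<dots> \<le> (1 - \<alpha> n) * (\<epsilon> + (C n - C N) + P) + \<alpha> n * \<epsilon> + c n"
      using step N2[of n] \<alpha>[of n]
      by (intro add_mono mult_left_mono) (auto simp: P_def N_def)
    also have "\<dots> = \<epsilon> + (1 - \<alpha> n) * (C n - C N) + (1 - \<alpha> n) * P + c n"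
      by (simp add: algebra_simps)
    also have "\<dots> \<le> \<epsilon> + 1 * (C n - C N) + exp (- \<alpha> n) * P + c n"
      using \<alpha>[of n] P \<open>C N \<le> C n\<close> exp_ge_add_one_self[of "- \<alpha> n"]
      by (intro add_mono mult_right_mono) auto
    also have "exp (- \<alpha> n) * P = a N * exp (- (A (Suc n) - A N))"
      by (simp add: P_def A_def exp_add[symmetric] algebra_simps)
    finally show ?case by (simp add: C_def algebra_simps)
  qed
  have "filterlim (\<lambda>n. A n - A N) at_top sequentially"
    using filterlim_tendsto_add_at_top[OF tendsto_const[of "- A N"] div] by (simp add: A_def)
  then have "(\<lambda>n. exp (- (A n - A N))) \<longlonglongrightarrow> 0"
    by (intro filterlim_compose[OF exp_at_bot] filterlim_compose[OF filterlim_uminus_at_bot_at_top])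
  from tendsto_mult_right_zero[OF this, of "a N"]
  obtain N3 where N3: "\<And>n. n \<ge> N3 \<Longrightarrow> norm (a N * exp (- (A n - A N))) < \<epsilon>"
    using LIMSEQ_D[OF _ \<epsilon>] by fastforce
  show "\<exists>no. \<forall>n\<ge>no. norm (a n - 0) < r"
  proof (intro exI allI impI)
    fix n assume n: "n \<ge> max N N3"
    have "C n - C N < \<epsilon>" using N1[of n N] n by (simp add: N_def)
    with bound[of n] N3[of n] n have "a n < \<epsilon> + \<epsilon> + \<epsilon>" by auto
    then show "norm (a n - 0) < r" using a[of n] by (simp add: \<epsilon>_def)
  qed
qed

section \<open>Nonexpansive maps and monotonicity\<close>

lemma nonexpansiveD: "nonexpansive T \<Longrightarrow> norm (T x - T y) \<le> norm (x - y)"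
  by (simp add: nonexpansive_def)

lemma nonexpansive_continuous:
  assumes "nonexpansive T"
  shows "continuous_on UNIV T"
  using assms by (intro lipschitz_on_continuous_on[where L = 1])
    (auto simp: lipschitz_on_def nonexpansive_def dist_norm)

lemma nonexpansive_monotone:
  fixes U :: "'a::real_inner \<Rightarrow> 'a"
  assumes "nonexpansive U"
  shows "0 \<le> inner ((x - U x) - (y - U y)) (x - y)"
proof -
  have "inner (U x - U y) (x - y) \<le> norm (U x - U y) * norm (x - y)"
    by (rule norm_cauchy_schwarz)
  also have "\<dots> \<le> norm (x - y) * norm (x - y)"
    using nonexpansiveD[OF assms] by (intro mult_right_mono) auto
  also have "\<dots> = inner (x - y) (x - y)"
    by (simp add: power2_norm_eq_inner[symmetric] power2_eq_square)
  finally show ?thesis by (simp add: inner_diff_left)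
qed

section \<open>The regularised equation and its limit\<close>

text \<open>The equation says \<open>(1 + t) *\<^sub>R x = U x\<close>, so \<open>x\<close> is the
  fixed point of the contraction \<open>U / (1 + t)\<close>.\<close>

lemma regularised_fixed_point_exists:
  fixes U :: "'a::{real_inner, complete_space} \<Rightarrow> 'a"
  assumes "nonexpansive U" and "t > 0"
  shows "\<exists>x. x - U x = - t *\<^sub>R x"
proof -
  define f where "f x = (1 / (1 + t)) *\<^sub>R U x" for x
  have "dist (f x) (f y) \<le> (1 / (1 + t)) * dist x y" for x y
  proof -
    have "dist (f x) (f y) = (1 / (1 + t)) * norm (U x - U y)"
      using assms(2) by (simp add: f_def dist_norm scaleR_diff_right[symmetric])
    also have "\<dots> \<le> (1 / (1 + t)) * norm (x - y)"
      using assms by (intro mult_left_mono nonexpansiveD) auto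
    finally show ?thesis by (simp add: dist_norm)
  qed
  then obtain x where "f x = x"
    using banach_fix_type[of "1 / (1 + t)" f] assms(2) by auto
  then have "(1 + t) *\<^sub>R x = (1 + t) *\<^sub>R ((1 / (1 + t)) *\<^sub>R U x)"
    by (simp add: f_def)
  also have "\<dots> = U x" using assms(2) by simp
  finally have "U x = x + t *\<^sub>R x" by (simp add: scaleR_add_left)
  then show ?thesis by (intro exI[of _ x]) simp
qed

text \<open>This is monotonicity expanded by polarisation. For \<open>s > t > 0\<close> it gives at
  once that \<open>y\<close> has the larger norm and that the squared distance is at most the gap
  between the squared norms.\<close>

lemma regularised_fixed_points_dist:
  fixes U :: "'a::real_inner \<Rightarrow> 'a"
  assumes "nonexpansive U"
    and x: "x - U x = - s *\<^sub>R x" and y: "y - U y = - t *\<^sub>R y"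
  shows "(s + t) * (norm (x - y))\<^sup>2 \<le> (s - t) * ((norm y)\<^sup>2 - (norm x)\<^sup>2)"
proof -
  have "0 \<le> inner ((- s *\<^sub>R x) - (- t *\<^sub>R y)) (x - y)"
    using nonexpansive_monotone[OF assms(1), of x y] by (simp only: x y)
  then show ?thesis
    unfolding power2_norm_eq_inner
    by (simp add: inner_diff_left inner_diff_right inner_commute[of y x] algebra_simps)
qed

text \<open>Monotonicity between \<open>z\<close> and \<open>x\<close>, then Cauchy-Schwarz. It
  serves twice: for a fixed point \<open>z\<close> the right side is 0, and for an approximate fixed
  point it is small compared with \<open>t\<close>.\<close>

lemma regularised_fixed_point_inner_le:
  fixes U :: "'a::real_inner \<Rightarrow> 'a"
  assumes "nonexpansive U" and x: "x - U x = - t *\<^sub>R x"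
  shows "t * inner x (x - z) \<le> norm (z - U z) * norm (z - x)"
proof -
  have "0 \<le> inner ((z - U z) - (- t *\<^sub>R x)) (z - x)"
    using nonexpansive_monotone[OF assms(1), of z x] by (simp only: x)
  also have "\<dots> = inner (z - U z) (z - x) - t * inner x (x - z)"
    by (simp add: inner_diff_left inner_diff_right algebra_simps)
  also have "inner (z - U z) (z - x) \<le> norm (z - U z) * norm (z - x)"
    by (rule norm_cauchy_schwarz)
  finally show ?thesis by simp
qed

lemma inner_self_le_imp_norm_le:
  fixes p q :: "'a::real_inner"
  assumes "inner p p \<le> inner p q"
  shows "norm p \<le> norm q"
proof (cases "p = 0")
  case False
  have "norm p * norm p \<le> norm p * norm q"
    using assms norm_cauchy_schwarz[of p q]
    by (simp add: power2_norm_eq_inner[symmetric] power2_eq_square)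
  then show ?thesis using False by simp
qed simp

text \<open>Every fixed point bounds the norms of the \<open>x k\<close>, which increase and so
  converge; the distance estimate then makes \<open>x\<close> itself Cauchy. The inequality
  \<open>inner p p \<le> inner p q\<close> is the variational form of \<open>p\<close> being the
  projection of 0 onto \<open>Fix U\<close>.\<close>

lemma regularised_fixed_points_converge:
  fixes U :: "'a::{real_inner, complete_space} \<Rightarrow> 'a"
  assumes U: "nonexpansive U" and "Fix U \<noteq> {}"
  obtains x t p where "\<And>k::nat. t k > (0::real)" "\<And>k. x k - U (x k) = - t k *\<^sub>R x k"
    "x \<longlonglongrightarrow> p" "p \<in> Fix U" "\<And>q. q \<in> Fix U \<Longrightarrow> inner p p \<le> inner p q"
    "\<And>k. norm (x k) \<le> norm p"
proof -
  \<comment> \<open>Any strictly decreasing positive sequence with limit 0 would serve; strictness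
    lets \<open>t m = t n\<close> force \<open>m = n\<close> below.\<close>
  define t where "t k = 1 / (real k + 1)" for k
  have t: "t k > 0" for k by (simp add: t_def)
  have t_mono: "t n \<le> t m" if "m \<le> n" for m n
    using that by (simp add: t_def frac_le)
  have "\<exists>x. x - U x = - t k *\<^sub>R x" for k
    by (rule regularised_fixed_point_exists[OF U t])
  then obtain x where x: "\<And>k. x k - U (x k) = - t k *\<^sub>R x k" by metis
  have inner_le: "inner (x k) (x k) \<le> inner (x k) q" if "q \<in> Fix U" for k q
    using regularised_fixed_point_inner_le[OF U x, of k q] that t[of k]
    by (simp add: Fix_def inner_diff_right mult_le_0_iff)
  obtain q where q: "q \<in> Fix U" using assms(2) by auto
  define a where "a k = (norm (x k))\<^sup>2" for k
  have a_diff: "(norm (x m - x n))\<^sup>2 \<le> a n - a m" if "m \<le> n" for m n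
  proof -
    have *: "(t m + t n) * (norm (x m - x n))\<^sup>2 \<le> (t m - t n) * (a n - a m)"
      unfolding a_def by (rule regularised_fixed_points_dist[OF U x x])
    show ?thesis
    proof (cases "t m = t n")
      case True
      then have "m = n" by (simp add: t_def)
      then show ?thesis by simp
    next
      case False
      then have lt: "t m - t n > 0" using t_mono[OF that] by simp
      \<comment> \<open>Lowering the factor \<open>t m + t n\<close> to \<open>t m - t n\<close>
        allows cancellation with the right side of \<open>*\<close>.\<close>
      have "(t m - t n) * (norm (x m - x n))\<^sup>2 \<le> (t m + t n) * (norm (x m - x n))\<^sup>2"
        using t[of n] by (intro mult_right_mono) auto
      with * have "(t m - t n) * (norm (x m - x n))\<^sup>2 \<le> (t m - t n) * (a n - a m)" by simp
      then show ?thesis using lt by simp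
    qed
  qed
  have "incseq a"
  proof (rule monoI)
    fix m n :: nat assume "m \<le> n"
    from a_diff[OF this] show "a m \<le> a n"
      using zero_le_power2[of "norm (x m - x n)"] by linarith
  qed
  moreover have "a k \<le> (norm q)\<^sup>2" for k
    using inner_self_le_imp_norm_le[OF inner_le[OF q]] by (simp add: a_def power_mono)
  ultimately obtain L where "a \<longlonglongrightarrow> L" using incseq_convergent by blast
  then have "Cauchy a" by (rule LIMSEQ_imp_Cauchy)
  have "Cauchy x"
  proof (rule CauchyI')
    fix r :: real assume r: "r > 0"
    then obtain M where M: "\<And>m n. m \<ge> M \<Longrightarrow> n \<ge> M \<Longrightarrow> norm (a m - a n) < r\<^sup>2"
      using CauchyD[OF \<open>Cauchy a\<close>, of "r\<^sup>2"] by auto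
    show "\<exists>M. \<forall>m\<ge>M. \<forall>n>m. dist (x m) (x n) < r"
    proof (intro exI allI impI)
      fix m n assume "M \<le> m" "m < n"
      then have "(norm (x m - x n))\<^sup>2 < r\<^sup>2"
        using a_diff[of m n] M[of n m] by auto
      then show "dist (x m) (x n) < r" using r by (simp add: dist_norm power2_less_imp_less)
    qed
  qed
  then obtain p where p: "x \<longlonglongrightarrow> p" using Cauchy_convergent convergent_def by blast
  have "t \<longlonglongrightarrow> 0" unfolding t_def using LIMSEQ_inverse_real_of_nat by (simp add: field_simps)
  have "(\<lambda>k. U (x k)) \<longlonglongrightarrow> U p"
    using nonexpansive_continuous[OF U] p by (rule continuous_on_tendsto_compose) auto
  moreover have "(\<lambda>k. x k - - t k *\<^sub>R x k) \<longlonglongrightarrow> p - - 0 *\<^sub>R p"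
    by (intro tendsto_intros p \<open>t \<longlonglongrightarrow> 0\<close>)
  \<comment> \<open>The regularised equation, read from right to left, turns the subtracted term
    into \<open>x k - U (x k)\<close>.\<close>
  moreover have "(\<lambda>k. x k - - t k *\<^sub>R x k) = (\<lambda>k. U (x k))"
    unfolding x[symmetric] by simp
  ultimately have "U p = p" using LIMSEQ_unique by fastforce
  then have pF: "p \<in> Fix U" by (simp add: Fix_def)
  have "inner p p \<le> inner p q" if "q \<in> Fix U" for q
    by (rule LIMSEQ_le[OF tendsto_inner[OF p p] tendsto_inner[OF p tendsto_const]])
      (use inner_le[OF that] in auto)
  moreover have "norm (x k) \<le> norm p" for k
    by (rule inner_self_le_imp_norm_le[OF inner_le[OF pF]])
  ultimately show ?thesis using that[OF t x p pF] by blast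
qed

text \<open>Comparison with one regularised point: \<open>k\<close> is chosen first, with
  \<open>x k\<close> close to \<open>p\<close>, and only then \<open>n\<close>, with the residual of
  \<open>z n\<close> small compared with \<open>t k\<close>. The point \<open>p\<close> is
  quantified before \<open>z\<close>, so it serves all such sequences.\<close>

lemma limsup_inner_approximate_fixed_points:
  fixes U :: "'a::{real_inner, complete_space} \<Rightarrow> 'a"
  assumes U: "nonexpansive U" and "Fix U \<noteq> {}"
  shows "\<exists>p\<in>Fix U. (\<forall>q\<in>Fix U. inner p p \<le> inner p q) \<and>
    (\<forall>z. Bseq z \<longrightarrow> (\<lambda>n. z n - U (z n)) \<longlonglongrightarrow> 0 \<longrightarrow>
      (\<forall>\<epsilon>>0. \<forall>\<^sub>F n in sequentially. inner p (p - z n) \<le> \<epsilon>))"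
proof -
  obtain x t p where t: "\<And>k::nat. t k > (0::real)" and x: "\<And>k. x k - U (x k) = - t k *\<^sub>R x k"
    and p: "x \<longlonglongrightarrow> p" "p \<in> Fix U" "\<And>q. q \<in> Fix U \<Longrightarrow> inner p p \<le> inner p q"
    and x_le: "\<And>k. norm (x k) \<le> norm p"
    using regularised_fixed_points_converge[OF assms] by metis
  have "\<forall>\<^sub>F n in sequentially. inner p (p - z n) \<le> \<epsilon>"
    if "Bseq z" and z: "(\<lambda>n. z n - U (z n)) \<longlonglongrightarrow> 0" and \<epsilon>: "\<epsilon> > 0" for z and \<epsilon> :: real
  proof -
    obtain B where B: "B > 0" "\<And>n. norm (z n) \<le> B" using \<open>Bseq z\<close> by (auto simp: Bseq_def)
    \<comment> \<open>Since \<open>norm (x k) \<le> norm p\<close>, this bounds both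
      \<open>z n - x k\<close> and \<open>p + x k - z n\<close>.\<close>
    define K where "K = 2 * norm p + B"
    have K: "K > 0" using B(1) by (simp add: K_def add_nonneg_pos)
    obtain k where k: "norm (x k - p) < \<epsilon> / (2 * K)"
      using LIMSEQ_D[OF p(1), of "\<epsilon> / (2 * K)"] \<epsilon> K by auto
    have "\<forall>\<^sub>F n in sequentially. norm (z n - U (z n)) < t k * (\<epsilon> / (2 * K))"
      using tendstoD[OF z, of "t k * (\<epsilon> / (2 * K))"] \<epsilon> K t[of k] by simp
    then show ?thesis
    proof (eventually_elim)
      case (elim n)
      have zx: "norm (z n - x k) \<le> K"
        using norm_triangle_ineq4[of "z n" "x k"] B(2)[of n] x_le[of k] norm_ge_zero[of p]
        unfolding K_def by linarith
      have "t k * inner (x k) (x k - z n) \<le> norm (z n - U (z n)) * norm (z n - x k)"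
        by (rule regularised_fixed_point_inner_le[OF U x])
      also have "\<dots> \<le> (t k * (\<epsilon> / (2 * K))) * K"
        by (rule mult_mono[OF less_imp_le[OF elim] zx]) (use t[of k] \<epsilon> K in simp_all)
      also have "\<dots> = t k * (\<epsilon> / 2)" using K by simp
      finally have 1: "inner (x k) (x k - z n) \<le> \<epsilon> / 2" using t[of k] by simp
      have "inner p (p - z n) - inner (x k) (x k - z n) = inner (p - x k) (p + x k - z n)"
        by (simp add: inner_diff_left inner_diff_right inner_add_right inner_commute)
      also have "\<dots> \<le> norm (p - x k) * norm (p + x k - z n)" by (rule norm_cauchy_schwarz)
      also have "\<dots> \<le> \<epsilon> / (2 * K) * K"
      proof (intro mult_mono)
        show "norm (p - x k) \<le> \<epsilon> / (2 * K)" using k by (simp add: norm_minus_commute)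
        show "norm (p + x k - z n) \<le> K"
          using norm_triangle_ineq4[of "p + x k" "z n"] norm_triangle_ineq[of p "x k"]
            B(2)[of n] x_le[of k] by (simp add: K_def)
      qed (use \<epsilon> K in auto)
      also have "\<dots> = \<epsilon> / 2" using K by simp
      finally show ?case using 1 by linarith
    qed
  qed
  then show ?thesis using p by blast
qed

section \<open>Projection of the origin\<close>

text \<open>The variational inequality makes \<open>p\<close> a point of least norm. For another
  such point \<open>r\<close>, expanding the square of \<open>r - p\<close> gives at most
  \<open>inner r r - inner p p\<close>, hence at most 0; this uniqueness settles the definite
  description.\<close>

lemma proj_0_eqI:
  assumes "p \<in> C" and p: "\<And>q. q \<in> C \<Longrightarrow> inner p p \<le> inner p q"
  shows "proj C 0 = p"
  unfolding proj_def
proof (rule the_equality)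
  show "p \<in> C \<and> (\<forall>z\<in>C. norm (0 - p) \<le> norm (0 - z))"
    using assms by (auto intro: inner_self_le_imp_norm_le)
next
  fix r assume r: "r \<in> C \<and> (\<forall>z\<in>C. norm (0 - r) \<le> norm (0 - z))"
  then have "norm r \<le> norm p" using \<open>p \<in> C\<close> by auto
  then have "inner r r \<le> inner p p"
    by (simp add: power2_norm_eq_inner[symmetric] power_mono)
  moreover have "inner p p \<le> inner p r" using p r by blast
  ultimately have "inner (r - p) (r - p) \<le> 0"
    by (simp add: inner_diff_left inner_diff_right inner_commute)
  then have "inner (r - p) (r - p) = 0" using inner_ge_zero[of "r - p"] by linarith
  then show "r = p" by simp
qed

section \<open>The midpoint map and relaxed maps\<close>

lemma nonexpansive_midpoint:
  assumes "nonexpansive S" "nonexpansive T"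
  shows "nonexpansive (\<lambda>x. (1 / 2) *\<^sub>R (S x + T x))"
  unfolding nonexpansive_def
proof (intro allI)
  fix x y
  have "(1 / 2) *\<^sub>R (S x + T x) - (1 / 2) *\<^sub>R (S y + T y)
      = (1 / 2) *\<^sub>R ((S x - S y) + (T x - T y))"
    by (simp add: algebra_simps)
  also have "norm \<dots> = (1 / 2) * norm ((S x - S y) + (T x - T y))" by simp
  also have "\<dots> \<le> (1 / 2) * (norm (x - y) + norm (x - y))"
    using assms by (intro mult_left_mono norm_triangle_mono nonexpansiveD) auto
  finally show "norm ((1 / 2) *\<^sub>R (S x + T x) - (1 / 2) *\<^sub>R (S y + T y)) \<le> norm (x - y)" by simp
qed

text \<open>Strict convexity through the parallelogram law: seen from a common fixed point
  \<open>q\<close>, both \<open>S x\<close> and \<open>T x\<close> are no farther than their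
  midpoint \<open>x\<close>, so they coincide.\<close>

lemma Fix_midpoint:
  fixes S T :: "'a::real_inner \<Rightarrow> 'a"
  assumes S: "nonexpansive S" and T: "nonexpansive T" and "Fix T \<inter> Fix S \<noteq> {}"
  shows "Fix (\<lambda>x. (1 / 2) *\<^sub>R (S x + T x)) = Fix T \<inter> Fix S"
proof (intro equalityI subsetI)
  fix x assume "x \<in> Fix (\<lambda>x. (1 / 2) *\<^sub>R (S x + T x))"
  then have "(1 / 2) *\<^sub>R (S x + T x) = x" by (simp add: Fix_def)
  then have "2 *\<^sub>R ((1 / 2) *\<^sub>R (S x + T x)) = 2 *\<^sub>R x" by simp
  then have sum: "S x + T x = 2 *\<^sub>R x" by simp
  obtain q where q: "S q = q" "T q = q" using assms(3) by (auto simp: Fix_def)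
  have uv: "(norm (S x - q))\<^sup>2 \<le> (norm (x - q))\<^sup>2" "(norm (T x - q))\<^sup>2 \<le> (norm (x - q))\<^sup>2"
    using nonexpansiveD[OF S, of x q] nonexpansiveD[OF T, of x q] q by (auto intro: power_mono)
  have "(norm (S x - T x))\<^sup>2
      = 2 * (norm (S x - q))\<^sup>2 + 2 * (norm (T x - q))\<^sup>2 - (norm ((S x + T x) - 2 *\<^sub>R q))\<^sup>2"
    unfolding power2_norm_eq_inner
    by (simp add: inner_diff_left inner_diff_right inner_add_left inner_add_right inner_commute)
  also have "(S x + T x) - 2 *\<^sub>R q = 2 *\<^sub>R (x - q)" by (simp add: sum algebra_simps)
  also have "2 * (norm (S x - q))\<^sup>2 + 2 * (norm (T x - q))\<^sup>2 - (norm (2 *\<^sub>R (x - q)))\<^sup>2 \<le> 0"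
  proof -
    have "(norm (2 *\<^sub>R (x - q)))\<^sup>2 = 4 * (norm (x - q))\<^sup>2"
      by (simp add: power_mult_distrib)
    then show ?thesis using uv by linarith
  qed
  finally have "S x = T x" by simp
  then have "2 *\<^sub>R S x = 2 *\<^sub>R x" using sum by (simp add: scaleR_2)
  with \<open>S x = T x\<close> show "x \<in> Fix T \<inter> Fix S" by (simp add: Fix_def)
qed (auto simp: Fix_def scaleR_2[symmetric])

lemma norm_convex_combination_sq:
  fixes a b :: "'a::real_inner"
  shows "(norm ((1 - u) *\<^sub>R a + u *\<^sub>R b))\<^sup>2
    = (1 - u) * (norm a)\<^sup>2 + u * (norm b)\<^sup>2 - u * (1 - u) * (norm (a - b))\<^sup>2"
  unfolding power2_norm_eq_inner
  by (simp add: inner_diff_left inner_diff_right inner_add_left inner_add_right inner_commute[of b a]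
      algebra_simps)

text \<open>The subtracted term is the gain from uniform convexity, supplied by
  \<open>norm_convex_combination_sq\<close>; it will control the residual of
  \<open>T\<close>.\<close>

lemma relaxed_dist_le:
  fixes T :: "'a::real_inner \<Rightarrow> 'a"
  assumes T: "nonexpansive T" and q: "T q = q" and u: "0 \<le> u" "u \<le> 1"
  shows "(norm ((1 - u) *\<^sub>R z + u *\<^sub>R T z - q))\<^sup>2
    \<le> (norm (z - q))\<^sup>2 - u * (1 - u) * (norm (z - T z))\<^sup>2"
proof -
  have eq: "(1 - u) *\<^sub>R z + u *\<^sub>R T z - q = (1 - u) *\<^sub>R (z - q) + u *\<^sub>R (T z - q)"
    by (simp add: algebra_simps)
  have "norm (T z - q) \<le> norm (z - q)" using nonexpansiveD[OF T, of z q] q by simp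
  then have "u * (norm (T z - q))\<^sup>2 \<le> u * (norm (z - q))\<^sup>2"
    using u by (intro mult_left_mono power_mono) auto
  then show ?thesis unfolding eq norm_convex_combination_sq by (simp add: algebra_simps)
qed

lemma nonexpansive_relaxed:
  assumes T: "nonexpansive T" and u: "0 \<le> u" "u \<le> 1"
  shows "nonexpansive (\<lambda>z. (1 - u) *\<^sub>R z + u *\<^sub>R T z)"
  unfolding nonexpansive_def
proof (intro allI)
  fix x y
  have "((1 - u) *\<^sub>R x + u *\<^sub>R T x) - ((1 - u) *\<^sub>R y + u *\<^sub>R T y)
      = (1 - u) *\<^sub>R (x - y) + u *\<^sub>R (T x - T y)"
    by (simp add: algebra_simps)
  also have "norm \<dots> \<le> (1 - u) * norm (x - y) + u * norm (T x - T y)"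
    using norm_triangle_ineq[of "(1 - u) *\<^sub>R (x - y)" "u *\<^sub>R (T x - T y)"] u by simp
  also have "\<dots> \<le> (1 - u) * norm (x - y) + u * norm (x - y)"
    using u by (intro add_mono mult_left_mono nonexpansiveD[OF T]) auto
  finally show "norm (((1 - u) *\<^sub>R x + u *\<^sub>R T x) - ((1 - u) *\<^sub>R y + u *\<^sub>R T y)) \<le> norm (x - y)"
    by (simp add: algebra_simps)
qed

section \<open>Convergence of the iteration\<close>

theorem theorem3p1:
  fixes S T :: "'a::{real_inner, complete_space} \<Rightarrow> 'a"
    and y :: "nat \<Rightarrow> 'a"
    and \<theta> e :: "nat \<Rightarrow> real"
    and \<theta>_lo \<theta>_hi :: real
  assumes "nonexpansive S" and "nonexpansive T"
    and "Fix T \<inter> Fix S \<noteq> {}"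
    and "\<And>n. n \<ge> 1 \<Longrightarrow>
          y (n + 1) = S ((1 - \<theta> n) *\<^sub>R (e n *\<^sub>R y n) + \<theta> n *\<^sub>R T (e n *\<^sub>R y n))"
    and "\<And>n. n \<ge> 1 \<Longrightarrow> 0 < e n \<and> e n < 1"
    and "e \<longlonglongrightarrow> 1"
    and "filterlim (\<lambda>N. \<Sum>n=1..N. 1 - e n) at_top sequentially"
    and "summable (\<lambda>n. \<bar>e (n + 2) - e (n + 1)\<bar>)"
    and "0 < \<theta>_lo" and "\<theta>_hi < 1"
    and "\<And>n. n \<ge> 1 \<Longrightarrow> \<theta>_lo \<le> \<theta> n \<and> \<theta> n \<le> \<theta>_hi"
    and "summable (\<lambda>n. \<bar>\<theta> (n + 2) - \<theta> (n + 1)\<bar>)"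
  shows "y \<longlonglongrightarrow> proj (Fix T \<inter> Fix S) 0"
proof -
  note S = assms(1) and T = assms(2)
  define U where "U x = (1 / 2) *\<^sub>R (S x + T x)" for x
  have U: "nonexpansive U" unfolding U_def by (rule nonexpansive_midpoint[OF S T])
  have FixU: "Fix U = Fix T \<inter> Fix S" unfolding U_def by (rule Fix_midpoint[OF S T assms(3)])
  have "Fix U \<noteq> {}" using FixU assms(3) by simp
  from limsup_inner_approximate_fixed_points[OF U this]
  obtain p where p: "p \<in> Fix U" "\<And>q. q \<in> Fix U \<Longrightarrow> inner p p \<le> inner p q"
    and limsup_p: "\<And>z \<epsilon>. Bseq z \<Longrightarrow> (\<lambda>n. z n - U (z n)) \<longlonglongrightarrow> 0 \<Longrightarrow> \<epsilon> > 0 \<Longrightarrow>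
      \<forall>\<^sub>F n in sequentially. inner p (p - z n) \<le> \<epsilon>"
    by blast
  have proj: "proj (Fix T \<inter> Fix S) 0 = p" using proj_0_eqI p FixU by metis
  have Sp: "S p = p" and Tp: "T p = p" using p(1) FixU by (auto simp: Fix_def)

  \<comment> \<open>Indices shift by one: \<open>Y 0\<close> is \<open>y 1\<close>, and the
    hypotheses for \<open>n \<ge> 1\<close> hold for every natural number.\<close>
  define Y where "Y n = y (Suc n)" for n
  define E where "E n = e (Suc n)" for n
  define H where "H n = \<theta> (Suc n)" for n
  define z where "z n = E n *\<^sub>R Y n" for n
  define V where "V n x = (1 - H n) *\<^sub>R x + H n *\<^sub>R T x" for n x
  have Y: "Y (Suc n) = S (V n (z n))" for n
    using assms(4)[of "Suc n"] by (simp add: Y_def E_def H_def z_def V_def)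
  have E: "0 < E n" "E n < 1" for n using assms(5)[of "Suc n"] by (auto simp: E_def)
  have H: "\<theta>_lo \<le> H n" "H n \<le> \<theta>_hi" for n using assms(11)[of "Suc n"] by (auto simp: H_def)
  have H01: "0 \<le> H n" "H n \<le> 1" for n using H[of n] assms(9,10) by auto
  have V: "nonexpansive (V n)" for n
    unfolding V_def by (rule nonexpansive_relaxed[OF T H01])
  have Vp: "V n p = p" for n by (simp add: V_def Tp algebra_simps)
  have E_lim: "E \<longlonglongrightarrow> 1" unfolding E_def using assms(6) by (rule LIMSEQ_Suc)
  have E_div: "filterlim (\<lambda>n. \<Sum>i<n. 1 - E i) at_top sequentially"
  proof -
    have "(\<Sum>i<n. 1 - E i) = (\<Sum>i=1..n. 1 - e i)" for n
      by (induction n) (auto simp: E_def)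
    then show ?thesis using assms(7) by simp
  qed
  \<comment> \<open>The recursion for successive differences has coefficient
    \<open>E (Suc n)\<close>, so divergence is needed with the first term removed.\<close>
  have E_div_Suc: "filterlim (\<lambda>n. \<Sum>i<n. 1 - E (Suc i)) at_top sequentially"
  proof -
    have "(\<Sum>i<n. 1 - E (Suc i)) = - (1 - E 0) + (\<Sum>i<Suc n. 1 - E i)" for n
      by (subst sum.lessThan_Suc_shift) simp
    moreover have "filterlim (\<lambda>n. - (1 - E 0) + (\<Sum>i<Suc n. 1 - E i)) at_top sequentially"
      by (intro filterlim_tendsto_add_at_top[OF tendsto_const]
          filterlim_compose[OF E_div filterlim_Suc])
    ultimately show ?thesis by simp
  qed

  \<comment> \<open>Boundedness of the iterates\<close>
  have Y_step: "norm (Y (Suc n) - p) \<le> norm (z n - p)" for n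
  proof -
    have "norm (Y (Suc n) - p) \<le> norm (V n (z n) - p)"
      using nonexpansiveD[OF S, of "V n (z n)" p] by (simp add: Y Sp)
    also have "\<dots> \<le> norm (z n - p)" using nonexpansiveD[OF V, of n "z n" p] by (simp add: Vp)
    finally show ?thesis .
  qed
  have z_p: "z n - p = E n *\<^sub>R (Y n - p) - (1 - E n) *\<^sub>R p" for n
    by (simp add: z_def algebra_simps)
  \<comment> \<open>By \<open>z_p\<close>, \<open>z n - p\<close> is a convex combination of
    \<open>Y n - p\<close> and \<open>- p\<close>; with \<open>R \<ge> norm p\<close> the ball of
    radius \<open>R\<close> about \<open>p\<close> is therefore invariant.\<close>
  define R where "R = max (norm (Y 0 - p)) (norm p)"
  have R0: "0 \<le> R" by (simp add: R_def le_max_iff_disj)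
  have z_R': "norm (z n - p) \<le> R" if "norm (Y n - p) \<le> R" for n
  proof -
    have "norm (z n - p) \<le> E n * norm (Y n - p) + (1 - E n) * norm p"
      unfolding z_p
      using norm_triangle_ineq4[of "E n *\<^sub>R (Y n - p)" "(1 - E n) *\<^sub>R p"] E[of n] by simp
    also have "\<dots> \<le> E n * R + (1 - E n) * R"
      using E[of n] that by (intro add_mono mult_left_mono) (auto simp: R_def)
    finally show ?thesis by (simp add: algebra_simps)
  qed
  have Y_R: "norm (Y n - p) \<le> R" for n
  proof (induction n)
    case (Suc n)
    then show ?case using Y_step[of n] z_R'[of n] by simp
  qed (simp add: R_def)
  have z_R: "norm (z n - p) \<le> R" for n using z_R' Y_R by blast
  define M where "M = R + norm p"
  have M: "norm (Y n) \<le> M" "norm (z n) \<le> M" "norm (T (z n)) \<le> M" for n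
    using norm_triangle_sub[of "Y n" p] norm_triangle_sub[of "z n" p] norm_triangle_sub[of "T (z n)" p]
      Y_R[of n] z_R[of n] nonexpansiveD[OF T, of "z n" p] Tp
    by (auto simp: M_def)
  have M0: "0 \<le> M" by (simp add: M_def R0)
  have "Bseq z" using M(2) by (rule BseqI')

  \<comment> \<open>Asymptotic regularity\<close>
  have "(\<lambda>n. norm (Y (Suc n) - Y n)) \<longlonglongrightarrow> 0"
  proof (rule xu_recursion_tendsto_0[where b = "\<lambda>_. 0" and \<alpha> = "\<lambda>n. 1 - E (Suc n)"
        and c = "\<lambda>n. M * \<bar>E (Suc n) - E n\<bar> + 2 * M * \<bar>H (Suc n) - H n\<bar>"])
    fix n
    have 1: "norm (z (Suc n) - z n) \<le> E (Suc n) * norm (Y (Suc n) - Y n) + M * \<bar>E (Suc n) - E n\<bar>"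
    proof -
      have "z (Suc n) - z n = E (Suc n) *\<^sub>R (Y (Suc n) - Y n) + (E (Suc n) - E n) *\<^sub>R Y n"
        by (simp add: z_def algebra_simps)
      also have "norm \<dots> \<le> E (Suc n) * norm (Y (Suc n) - Y n) + \<bar>E (Suc n) - E n\<bar> * norm (Y n)"
        using norm_triangle_ineq[of "E (Suc n) *\<^sub>R (Y (Suc n) - Y n)" "(E (Suc n) - E n) *\<^sub>R Y n"]
          E[of "Suc n"] by simp
      also have "\<bar>E (Suc n) - E n\<bar> * norm (Y n) \<le> M * \<bar>E (Suc n) - E n\<bar>"
        using M(1)[of n] by (subst mult.commute) (intro mult_right_mono, auto)
      finally show ?thesis by simp
    qed
    have 2: "norm (V (Suc n) (z n) - V n (z n)) \<le> 2 * M * \<bar>H (Suc n) - H n\<bar>"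
    proof -
      have "V (Suc n) (z n) - V n (z n) = (H (Suc n) - H n) *\<^sub>R (T (z n) - z n)"
        by (simp add: V_def algebra_simps)
      also have "norm \<dots> = norm (T (z n) - z n) * \<bar>H (Suc n) - H n\<bar>" by simp
      also have "\<dots> \<le> 2 * M * \<bar>H (Suc n) - H n\<bar>"
        using norm_triangle_ineq4[of "T (z n)" "z n"] M[of n] by (intro mult_right_mono) auto
      finally show ?thesis .
    qed
    \<comment> \<open>The argument and the relaxation parameter are changed one at a time: the first
      change contracts by \<open>E (Suc n)\<close> up to a summable error, the second is itself
      summable.\<close>
    have "norm (Y (Suc (Suc n)) - Y (Suc n)) \<le> norm (V (Suc n) (z (Suc n)) - V n (z n))"
      using nonexpansiveD[OF S] by (simp add: Y)
    also have "\<dots> \<le> norm (V (Suc n) (z (Suc n)) - V (Suc n) (z n)) + norm (V (Suc n) (z n) - V n (z n))"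
      using norm_triangle_ineq[of "V (Suc n) (z (Suc n)) - V (Suc n) (z n)" "V (Suc n) (z n) - V n (z n)"]
      by simp
    also have "norm (V (Suc n) (z (Suc n)) - V (Suc n) (z n)) \<le> norm (z (Suc n) - z n)"
      by (rule nonexpansiveD[OF V])
    finally show "norm (Y (Suc (Suc n)) - Y (Suc n)) \<le> (1 - (1 - E (Suc n))) * norm (Y (Suc n) - Y n)
        + (1 - E (Suc n)) * 0 + (M * \<bar>E (Suc n) - E n\<bar> + 2 * M * \<bar>H (Suc n) - H n\<bar>)"
      using 1 2 by simp
  next
    show "summable (\<lambda>n. M * \<bar>E (Suc n) - E n\<bar> + 2 * M * \<bar>H (Suc n) - H n\<bar>)"
      using assms(8,12) by (intro summable_add summable_mult) (simp_all add: E_def H_def)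
  qed (use E E_div_Suc M0 in \<open>auto simp: less_imp_le\<close>)
  then have Y_diff: "(\<lambda>n. Y (Suc n) - Y n) \<longlonglongrightarrow> 0" by (simp add: tendsto_norm_zero_iff)
  have Yz: "(\<lambda>n. Y n - z n) \<longlonglongrightarrow> 0"
  proof -
    have "(\<lambda>n. (1 - E n) * M) \<longlonglongrightarrow> (1 - 1) * M" by (intro tendsto_intros E_lim)
    then have "(\<lambda>n. (1 - E n) * M) \<longlonglongrightarrow> 0" by simp
    moreover have "\<forall>\<^sub>F n in sequentially. norm ((1 - E n) *\<^sub>R Y n) \<le> (1 - E n) * M"
      using E M(1) by (intro always_eventually allI) (simp add: mult_left_mono less_imp_le)
    ultimately have "(\<lambda>n. (1 - E n) *\<^sub>R Y n) \<longlonglongrightarrow> 0"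
      by (rule Lim_null_comparison[rotated])
    then show ?thesis by (simp add: z_def algebra_simps)
  qed
  have Yz_Suc: "(\<lambda>n. Y (Suc n) - z n) \<longlonglongrightarrow> 0"
    using tendsto_add[OF Y_diff Yz] by simp

  \<comment> \<open>Residuals of \<open>T\<close>, \<open>S\<close> and \<open>U\<close>\<close>
  \<comment> \<open>A positive lower bound for \<open>H n * (1 - H n)\<close>, uniform in
    \<open>n\<close>.\<close>
  define \<kappa> where "\<kappa> = \<theta>_lo * (1 - \<theta>_hi)"
  have \<kappa>: "\<kappa> > 0" using assms(9,10) by (simp add: \<kappa>_def)
  have "(\<lambda>n. (norm (z n - T (z n)))\<^sup>2) \<longlonglongrightarrow> 0"
  proof (rule tendsto_sandwich[OF _ _ tendsto_const])
    show "\<forall>\<^sub>F n in sequentially. (norm (z n - T (z n)))\<^sup>2 \<le> (2 * R / \<kappa>) * norm (Y (Suc n) - z n)"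
    proof (intro always_eventually allI)
      fix n
      have "norm (Y (Suc n) - p) \<le> norm (V n (z n) - p)"
        using nonexpansiveD[OF S, of "V n (z n)" p] by (simp add: Y Sp)
      then have "(norm (Y (Suc n) - p))\<^sup>2 \<le> (norm (V n (z n) - p))\<^sup>2" by (intro power_mono) auto
      also have "\<dots> \<le> (norm (z n - p))\<^sup>2 - H n * (1 - H n) * (norm (z n - T (z n)))\<^sup>2"
        unfolding V_def by (rule relaxed_dist_le[OF T Tp H01])
      finally have "H n * (1 - H n) * (norm (z n - T (z n)))\<^sup>2
          \<le> (norm (z n - p))\<^sup>2 - (norm (Y (Suc n) - p))\<^sup>2" by simp
      moreover have "\<kappa> * (norm (z n - T (z n)))\<^sup>2 \<le> H n * (1 - H n) * (norm (z n - T (z n)))\<^sup>2"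
        unfolding \<kappa>_def using H[of n] H01[of n] assms(9,10)
        by (intro mult_right_mono mult_mono) auto
      moreover have "(norm (z n - p))\<^sup>2 - (norm (Y (Suc n) - p))\<^sup>2
          = (norm (z n - p) + norm (Y (Suc n) - p)) * (norm (z n - p) - norm (Y (Suc n) - p))"
        by (simp add: power2_eq_square algebra_simps)
      \<comment> \<open>The sum of norms is at most \<open>2 * R\<close>; the difference is
        nonnegative by \<open>Y_step\<close> and bounded by the reverse triangle inequality.\<close>
      moreover have "\<dots> \<le> (2 * R) * norm (Y (Suc n) - z n)"
        using Y_step[of n] z_R[of n] Y_R[of "Suc n"] R0
          norm_triangle_ineq2[of "z n - p" "Y (Suc n) - p"]
        by (intro mult_mono) (auto simp: norm_minus_commute)
      ultimately have "\<kappa> * (norm (z n - T (z n)))\<^sup>2 \<le> (2 * R) * norm (Y (Suc n) - z n)" by linarith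
      then show "(norm (z n - T (z n)))\<^sup>2 \<le> (2 * R / \<kappa>) * norm (Y (Suc n) - z n)"
        using \<kappa> by (simp add: field_simps)
    qed
    show "(\<lambda>n. (2 * R / \<kappa>) * norm (Y (Suc n) - z n)) \<longlonglongrightarrow> 0"
      by (intro tendsto_mult_right_zero tendsto_norm_zero Yz_Suc)
  qed auto
  then have "(\<lambda>n. sqrt ((norm (z n - T (z n)))\<^sup>2)) \<longlonglongrightarrow> sqrt 0" by (rule tendsto_real_sqrt)
  then have zT: "(\<lambda>n. norm (z n - T (z n))) \<longlonglongrightarrow> 0" by simp
  have zS: "(\<lambda>n. norm (z n - S (z n))) \<longlonglongrightarrow> 0"
  proof (rule tendsto_sandwich[OF _ _ tendsto_const])
    show "\<forall>\<^sub>F n in sequentially.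
        norm (z n - S (z n)) \<le> norm (Y (Suc n) - z n) + norm (z n - T (z n))"
    proof (intro always_eventually allI)
      fix n
      \<comment> \<open>Since \<open>Y (Suc n) = S (V n (z n))\<close>, the distance from
        \<open>Y (Suc n)\<close> to \<open>S (z n)\<close> is controlled by how far
        \<open>V n\<close> moves \<open>z n\<close>, hence by the residual of
        \<open>T\<close>.\<close>
      have "V n (z n) - z n = H n *\<^sub>R (T (z n) - z n)" by (simp add: V_def algebra_simps)
      then have "norm (V n (z n) - z n) = H n * norm (z n - T (z n))"
        using H01[of n] by (simp add: norm_minus_commute)
      also have "\<dots> \<le> norm (z n - T (z n))"
        using H01[of n] by (intro mult_left_le_one_le) auto
      finally have "norm (Y (Suc n) - S (z n)) \<le> norm (z n - T (z n))"
        using nonexpansiveD[OF S, of "V n (z n)" "z n"] by (simp add: Y)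
      then show "norm (z n - S (z n)) \<le> norm (Y (Suc n) - z n) + norm (z n - T (z n))"
        using norm_triangle_ineq4[of "Y (Suc n) - S (z n)" "Y (Suc n) - z n"]
        by (simp add: algebra_simps)
    qed
    show "(\<lambda>n. norm (Y (Suc n) - z n) + norm (z n - T (z n))) \<longlonglongrightarrow> 0"
      using tendsto_add[OF tendsto_norm_zero[OF Yz_Suc] zT] by simp
  qed auto
  have zU: "(\<lambda>n. z n - U (z n)) \<longlonglongrightarrow> 0"
  proof -
    have "(\<lambda>n. (1 / 2) *\<^sub>R ((z n - S (z n)) + (z n - T (z n)))) \<longlonglongrightarrow> (1 / 2) *\<^sub>R (0 + 0)"
      using zS zT by (intro tendsto_intros) (auto simp: tendsto_norm_zero_iff)
    moreover have "(1 / 2) *\<^sub>R ((z n - S (z n)) + (z n - T (z n))) = z n - U (z n)" for n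
    proof -
      have "(1 / 2) *\<^sub>R ((z n - S (z n)) + (z n - T (z n)))
          = (1 / 2) *\<^sub>R (2 *\<^sub>R z n) - (1 / 2) *\<^sub>R (S (z n) + T (z n))"
        unfolding scaleR_diff_right[symmetric] by (simp add: scaleR_2)
      then show ?thesis by (simp add: U_def)
    qed
    ultimately show ?thesis by simp
  qed

  \<comment> \<open>Strong convergence\<close>
  have "(\<lambda>n. (norm (Y n - p))\<^sup>2) \<longlonglongrightarrow> 0"
  proof (rule xu_recursion_tendsto_0[where b = "\<lambda>n. 2 * inner p (p - z n)"
        and \<alpha> = "\<lambda>n. 1 - E n" and c = "\<lambda>_. 0"])
    fix \<epsilon> :: real assume "\<epsilon> > 0"
    then have "\<forall>\<^sub>F n in sequentially. inner p (p - z n) \<le> \<epsilon> / 2"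
      by (intro limsup_p \<open>Bseq z\<close> zU) auto
    then show "\<forall>\<^sub>F n in sequentially. 2 * inner p (p - z n) \<le> \<epsilon>"
      by eventually_elim simp
  next
    fix n
    have "(norm (Y (Suc n) - p))\<^sup>2 \<le> (norm (z n - p))\<^sup>2"
      using Y_step[of n] by (intro power_mono) auto
    \<comment> \<open>By \<open>z_p\<close>, the first square on the right is that of
      \<open>E n *\<^sub>R (Y n - p)\<close>. Expanding about \<open>z n - p\<close> leaves an inner
      product with \<open>z n\<close>, the sequence to which \<open>limsup_p\<close>
      applies.\<close>
    moreover have "(norm (z n - p))\<^sup>2 = (norm ((z n - p) + (1 - E n) *\<^sub>R p))\<^sup>2
        - (1 - E n) * (2 * inner p (z n - p)) - (norm ((1 - E n) *\<^sub>R p))\<^sup>2"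
      unfolding power2_norm_eq_inner
      by (simp add: inner_add_left inner_add_right inner_commute[of "z n - p" p]
          distrib_left)
    moreover have "(norm ((z n - p) + (1 - E n) *\<^sub>R p))\<^sup>2 \<le> E n * (norm (Y n - p))\<^sup>2"
    proof -
      have "(norm ((z n - p) + (1 - E n) *\<^sub>R p))\<^sup>2 = E n * (E n * (norm (Y n - p))\<^sup>2)"
        by (simp add: z_p power2_eq_square)
      also have "\<dots> \<le> E n * (norm (Y n - p))\<^sup>2"
        using E[of n] by (intro mult_left_mono mult_left_le_one_le) auto
      finally show ?thesis .
    qed
    moreover have "(1 - E n) * (2 * inner p (z n - p)) = - ((1 - E n) * (2 * inner p (p - z n)))"
      by (simp add: inner_diff_right right_diff_distrib)
    ultimately have "(norm (Y (Suc n) - p))\<^sup>2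
        \<le> E n * (norm (Y n - p))\<^sup>2 + (1 - E n) * (2 * inner p (p - z n))"
      using zero_le_power2[of "norm ((1 - E n) *\<^sub>R p)"] by linarith
    then show "(norm (Y (Suc n) - p))\<^sup>2 \<le> (1 - (1 - E n)) * (norm (Y n - p))\<^sup>2
        + (1 - E n) * (2 * inner p (p - z n)) + 0" by simp
  qed (use E E_div in \<open>auto simp: less_imp_le\<close>)
  then have "(\<lambda>n. sqrt ((norm (Y n - p))\<^sup>2)) \<longlonglongrightarrow> sqrt 0" by (rule tendsto_real_sqrt)
  then have "(\<lambda>n. norm (Y n - p)) \<longlonglongrightarrow> 0" by simp
  then have "(\<lambda>n. y (Suc n)) \<longlonglongrightarrow> p"
    unfolding Y_def by (simp add: tendsto_norm_zero_iff LIM_zero_iff)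
  then show ?thesis unfolding proj by (rule LIMSEQ_imp_Suc)
qed

end
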